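(* For all integers $n\geq 0$ and $\alpha\geq 0$, $$\overline{OPT}(2^\alpha(8n+7))\equiv 0 \pmod{16}.$$
   Context: An overpartition of a nonnegative integer $n$ is a non-increasing sequence of positive integers with sum $n$ in which the first occurrence of each number may be overlined. An overpartition triple of $n$ with odd parts is an (ordered) triple $(\xi_1,\xi_2,\xi_3)$ of overpartitions, all of whose parts are odd, such that the sum of all the parts of $\xi_1,\xi_2,\xi_3$ is $n$. $\overline{OPT}(n)$ denotes the number of overpartition triples of $n$ with odd parts. Its generating function is $$\sum_{n\geq 0}\overline{OPT}(n)q^n=\frac{f_2^9}{f_1^6f_4^3}=\prod_{i\geq 0}\left(\frac{1+q^{2i+1}}{1-q^{2i+1}}\right)^3,\qquad f_k:=\prod_{i\geq 1}(1-q^{ki}).$$ *)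

theory Defs
  imports Main "HOL-Number_Theory.Cong"
begin

(* A part is a pair (k, b): k is its size and b tells whether it is overlined. *)
type_synonym part = "nat \<times> bool"

definition overpartition :: "part list \<Rightarrow> bool" where
  "overpartition xs \<longleftrightarrow>
     sorted_wrt (\<ge>) (map fst xs) \<and>
     (\<forall>p\<in>set xs. fst p > 0) \<and>
     (\<forall>i<length xs. snd (xs ! i) \<longrightarrow> (\<forall>j<i. fst (xs ! j) \<noteq> fst (xs ! i)))"

definition odd_parts :: "part list \<Rightarrow> bool" where
  "odd_parts xs \<longleftrightarrow> (\<forall>p\<in>set xs. odd (fst p))"

definition weight :: "part list \<Rightarrow> nat" where
  "weight xs = sum_list (map fst xs)"

definition odd_overpartition_triples :: "nat \<Rightarrow> (part list \<times> part list \<times> part list) set" where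
  "odd_overpartition_triples n =
     {(x, y, z). overpartition x \<and> overpartition y \<and> overpartition z \<and>
        odd_parts x \<and> odd_parts y \<and> odd_parts z \<and>
        weight x + weight y + weight z = n}"

definition OPT :: "nat \<Rightarrow> nat" where
  "OPT n = card (odd_overpartition_triples n)"

(* The set counted by OPT is finite, so the cardinality is a genuine count. *)

lemma length_le_weight: "overpartition xs \<Longrightarrow> length xs \<le> weight xs"
proof -
  assume "overpartition xs"
  then have "\<forall>p\<in>set xs. fst p > 0" by (simp add: overpartition_def)
  then show ?thesis by (induction xs) (auto simp: weight_def)
qed

lemma finite_overpartitions_le: "finite {xs. overpartition xs \<and> weight xs \<le> n}"
proof (rule finite_subset[OF _ finite_lists_length_le])
  show "{xs. overpartition xs \<and> weight xs \<le> n}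
          \<subseteq> {xs. set xs \<subseteq> {..n} \<times> UNIV \<and> length xs \<le> n}"
  proof (rule subsetI, rule CollectI, rule conjI)
    fix xs :: "part list" assume "xs \<in> {xs. overpartition xs \<and> weight xs \<le> n}"
    then have xs: "overpartition xs" "weight xs \<le> n" by auto
    show "length xs \<le> n" using length_le_weight[OF xs(1)] xs(2) by simp
    have "fst p \<le> n" if "p \<in> set xs" for p
      using member_le_sum_list[of "fst p" "map fst xs"] that xs(2)
      by (auto simp: weight_def)
    then show "set xs \<subseteq> {..n} \<times> UNIV" by auto
  qed
  show "finite ({..n} \<times> (UNIV :: bool set))" by simp
qed

lemma finite_odd_overpartition_triples: "finite (odd_overpartition_triples n)"
proof (rule finite_subset)
  let ?A = "{xs. overpartition xs \<and> weight xs \<le> n}"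
  show "odd_overpartition_triples n \<subseteq> ?A \<times> ?A \<times> ?A"
    by (auto simp: odd_overpartition_triples_def)
  show "finite (?A \<times> ?A \<times> ?A)"
    by (intro finite_cartesian_product finite_overpartitions_le)
qed

end

theory Submission
  imports Defs "HOL-Computational_Algebra.Formal_Power_Series"
begin

text \<open>Let \<open>G\<close> be the generating function of overpartitions with odd parts and
  \<open>\<phi>(-q) = 1 + 2 A\<close>, \<open>\<phi>(-q\<^sup>2) = 1 + 2 B\<close> with \<open>A\<close>, \<open>B\<close> supported on the positive numbers
  \<open>k\<^sup>2\<close> and \<open>2 k\<^sup>2\<close>. Gauss's product for \<open>\<phi>\<close> gives \<open>G = \<phi>(-q\<^sup>2) / \<phi>(-q)\<close>, hence
  \<open>G\<^sup>3 = (1 + 2 B)\<^sup>3 (1 + 2 A)\<^sup>5\<close> modulo 16. In the expansion the only cubic terms surviving modulo 16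
  are \<open>8 (A + B) B\<^sup>2\<close>, and \<open>B\<^sup>2\<close> is congruent modulo 2 to a series \<open>C\<close> supported on the
  numbers \<open>4 k\<^sup>2\<close>. So every nonconstant term has its exponents among the values of
  \<open>x\<^sup>2 + y\<^sup>2\<close> and \<open>x\<^sup>2 + 2 y\<^sup>2\<close>, and neither form represents \<open>2^a (8 n + 7)\<close>: modulo 8 if
  \<open>a = 0\<close>, and by halving otherwise.\<close>

unbundle fps_syntax

section \<open>Finite form of Gauss's square series\<close>

text \<open>Shanks's finite form of Gauss's identity \<open>\<phi>(-q) = \<Prod>k. (1 - q^k) / (1 + q^k)\<close>, multiplied out
  so that it holds in every commutative ring. The induction step telescopes.\<close>

lemma shanks_squares:
  fixes q :: "'a::comm_ring_1"
  shows "(\<Prod>k=1..n. 1 + q ^ k) * (1 + 2 * (\<Sum>s=1..n. (-1) ^ s * q ^ s\<^sup>2)) =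
    (\<Prod>k=1..n. 1 - q ^ k) +
    2 * (\<Sum>s=1..n. (-1) ^ s * q ^ (s * Suc n) * (\<Prod>k=1..<s. 1 + q ^ k) * (\<Prod>k=Suc s..n. 1 - q ^ k))"
proof (induction n)
  case 0
  show ?case by simp
next
  case (Suc n)
  define B where "B s = (\<Prod>k=1..<s. 1 + q ^ k)" for s
  define P where "P s m = (\<Prod>k=s..m. 1 - q ^ k)" for s m :: nat
  define T where "T m s = (-1) ^ s * q ^ (s * Suc m) * B s * P (Suc s) m" for m s
  \<comment> \<open>\<open>W\<close> is the telescoping term:
    \<open>T (Suc n) s - (1 + q ^ Suc n) * T n s\<close> will equal
    \<open>W (Suc s) - W s\<close>.\<close>
  define W where "W s = (-1) ^ s * q ^ (s * Suc n) * B s * P s n" for s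
  define S where "S m = (\<Sum>s=1..m. (-1) ^ s * q ^ s\<^sup>2)" for m :: nat
  have B_Suc: "B (Suc s) = B s * (1 + q ^ s)" if "s \<ge> 1" for s
    using that by (simp add: B_def prod.atLeastLessThan_Suc)
  have P_Suc: "P s (Suc n) = P s n * (1 - q ^ Suc n)" if "s \<le> Suc n" for s
    using that by (simp add: P_def)
  have P_step: "P s n = (1 - q ^ s) * P (Suc s) n" if "s \<le> n" for s
    using that by (simp add: P_def prod.atLeast_Suc_atMost)
  have IH: "B (Suc n) * (1 + 2 * S n) = P 1 n + 2 * (\<Sum>s=1..n. T n s)"
    using Suc.IH by (simp add: B_def P_def T_def S_def atLeastLessThanSuc_atLeastAtMost)
  have step: "T (Suc n) s = (1 + q ^ Suc n) * T n s + (W (Suc s) - W s)" if "s \<in> {1..n}" for s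
  proof -
    have s: "1 \<le> s" "s \<le> n" using that by auto
    have e: "q ^ (s * Suc (Suc n)) = q ^ (s * Suc n) * q ^ s"
            "q ^ (Suc s * Suc n) = q ^ (s * Suc n) * q ^ Suc n"
      by (simp_all add: power_add[symmetric] algebra_simps)
    show ?thesis
      unfolding T_def W_def e B_Suc[OF s(1)] P_step[OF s(2)]
      using s by (simp only: P_Suc Suc_le_mono power_Suc[of "-1"]) (simp add: algebra_simps)
  qed
  have "(\<Sum>s=1..n. T (Suc n) s) = (1 + q ^ Suc n) * (\<Sum>s=1..n. T n s) + (W (Suc n) - W 1)"
    using sum_Suc_diff[of 1 n W] by (simp add: step sum.distrib sum_distrib_left del: sum.atLeastLessThan_Suc)
  moreover have "T (Suc n) (Suc n) = (-1) ^ Suc n * q ^ (Suc n * Suc n) * q ^ Suc n * B (Suc n)"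
    by (simp add: T_def P_def algebra_simps power_add)
  ultimately have sT: "(\<Sum>s=1..Suc n. T (Suc n) s) = (1 + q ^ Suc n) * (\<Sum>s=1..n. T n s)
      + (W (Suc n) - W 1) + (-1) ^ Suc n * q ^ (Suc n * Suc n) * q ^ Suc n * B (Suc n)"
    by simp
  have W_last: "W (Suc n) = (-1) ^ Suc n * q ^ (Suc n * Suc n) * B (Suc n)"
    by (simp add: W_def P_def)
  have W_first: "W 1 = - (q ^ Suc n * P 1 n)"
    by (simp add: W_def B_def)
  have S_Suc: "S (Suc n) = S n + (-1) ^ Suc n * q ^ (Suc n * Suc n)"
    by (simp add: S_def power2_eq_square)
  have "B (Suc (Suc n)) * (1 + 2 * S (Suc n)) = (1 + q ^ Suc n) * (B (Suc n) * (1 + 2 * S n))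
      + 2 * ((-1) ^ Suc n * q ^ (Suc n * Suc n) * B (Suc n) * (1 + q ^ Suc n))"
    using B_Suc[of "Suc n"] unfolding S_Suc by (simp add: algebra_simps del: power_Suc mult_Suc mult_Suc_right)
  \<comment> \<open>\<open>W (Suc n)\<close> and the last \<open>T\<close> supply the new square
    term; \<open>- W 1\<close>, doubled, is the difference between
    \<open>(1 + q ^ Suc n) * P 1 n\<close> and \<open>P 1 (Suc n)\<close>.\<close>
  also have "\<dots> = P 1 (Suc n) + 2 * (\<Sum>s=1..Suc n. T (Suc n) s)"
    unfolding IH sT W_last W_first by (subst P_Suc) (simp_all add: algebra_simps)
  finally show ?case
    by (simp only: B_def P_def T_def S_def atLeastLessThanSuc_atLeastAtMost)
qed

section \<open>Truncated theta series\<close>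

text \<open>Divisibility by \<open>fps_X ^ n\<close> serves as congruence up to order
  \<open>n\<close>: infinite products are replaced by finite ones and such congruences for every
  \<open>n\<close>.\<close>

lemma fps_X_power_dvd_iff:
  fixes f :: "'a::comm_ring_1 fps"
  shows "fps_X ^ n dvd f \<longleftrightarrow> (\<forall>k<n. f $ k = 0)"
proof
  assume "fps_X ^ n dvd f"
  then show "\<forall>k<n. f $ k = 0" by (auto simp: dvd_def fps_X_power_mult_nth)
next
  assume "\<forall>k<n. f $ k = 0"
  then have "f = fps_X ^ n * fps_shift n f"
    by (intro fps_ext) (simp add: fps_X_power_mult_nth)
  then show "fps_X ^ n dvd f" by (rule dvdI)
qed

text \<open>Once the lower coefficients of \<open>f\<close> are known to vanish, coefficient
  \<open>k\<close> of \<open>f * g\<close> is \<open>f $ k\<close>, because \<open>g\<close> has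
  constant term 1.\<close>

lemma fps_X_power_dvd_cancel:
  fixes f g :: "'a::comm_ring_1 fps"
  assumes dvd: "fps_X ^ n dvd f * g" and g0: "g $ 0 = 1"
  shows "fps_X ^ n dvd f"
proof -
  have "f $ k = 0" if "k < n" for k
    using that
  proof (induction k rule: less_induct)
    case (less k)
    have "(f * g) $ k = (\<Sum>i=0..k. f $ i * g $ (k - i))" by (rule fps_mult_nth)
    also have "\<dots> = (\<Sum>i\<in>{k}. f $ i * g $ (k - i))"
      using less by (intro sum.mono_neutral_right) auto
    finally show ?case using dvd less.prems g0 by (simp add: fps_X_power_dvd_iff)
  qed
  then show ?thesis by (simp add: fps_X_power_dvd_iff)
qed

text \<open>\<open>1 + 2 * theta_tail r\<close> is \<open>\<phi>(-q\<^sup>r)\<close>; the sign of the term \<open>q^(r k\<^sup>2)\<close> is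
  \<open>(-1)^k = (-1)^(k\<^sup>2)\<close>.\<close>

definition theta_tail :: "nat \<Rightarrow> int fps" where
  "theta_tail r = Abs_fps (\<lambda>n. if \<exists>k>0. n = r * k\<^sup>2 then (-1) ^ (n div r) else 0)"

lemma theta_tail_nth_eq_0:
  assumes "\<nexists>k. n = r * k\<^sup>2"
  shows "theta_tail r $ n = 0"
  using assms by (auto simp: theta_tail_def)

text \<open>For \<open>s > n\<close> the exponent \<open>r * s\<^sup>2\<close> exceeds
  \<open>n\<close>, so truncating the sum at \<open>n\<close> loses nothing.\<close>

lemma theta_tail_cong_sum:
  assumes r: "r > 0"
  shows "fps_X ^ Suc n dvd theta_tail r - (\<Sum>s=1..n. (-1) ^ s * (fps_X ^ r) ^ s\<^sup>2)"
proof -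
  have sgn: "(-1 :: int fps) ^ s = fps_const ((-1) ^ s)" for s
    by (simp flip: fps_const_power fps_const_neg)
  have "theta_tail r $ k = (\<Sum>s=1..n. (-1) ^ s * (fps_X ^ r) ^ s\<^sup>2) $ k" if k: "k \<le> n" for k
  proof -
    have "(\<Sum>s=1..n. (-1) ^ s * (fps_X ^ r :: int fps) ^ s\<^sup>2) $ k =
        (\<Sum>s=1..n. if k = r * s\<^sup>2 then (-1) ^ s else 0)"
      by (simp add: fps_sum_nth sgn power_mult[symmetric] if_distrib cong: if_cong)
    also have "\<dots> = theta_tail r $ k"
    proof (cases "\<exists>j>0. k = r * j\<^sup>2")
      case True
      then obtain j where j: "j > 0" "k = r * j\<^sup>2" by blast
      have "j \<le> r * j\<^sup>2" using r by (simp add: power2_eq_square)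
      then have jn: "j \<in> {1..n}" using j k by simp
      have inj: "k = r * s\<^sup>2 \<longleftrightarrow> s = j" for s using j r by auto
      have "k div r = j\<^sup>2" using j r by simp
      then have "theta_tail r $ k = (-1) ^ j"
        using True by (simp add: theta_tail_def minus_one_power_iff)
      then show ?thesis using jn by (simp add: inj)
    next
      case False
      then have "k \<noteq> r * s\<^sup>2" if "s > 0" for s using that by blast
      then have "(\<Sum>s=1..n. if k = r * s\<^sup>2 then (-1) ^ s else 0 :: int) = 0"
        by (intro sum.neutral ballI) simp
      moreover have "theta_tail r $ k = 0" using False by (simp only: theta_tail_def fps_nth_Abs_fps if_False)
      ultimately show ?thesis by simp
    qed
    finally show ?thesis by simp
  qed
  then show ?thesis by (simp add: fps_X_power_dvd_iff less_Suc_eq_le del: power_Suc)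
qed

text \<open>In Shanks's identity with \<open>q = fps_X ^ r\<close>, each remainder term carries
  \<open>q ^ (s * Suc n)\<close> with \<open>s \<ge> 1\<close> and dies modulo
  \<open>fps_X ^ Suc n\<close>.\<close>

lemma theta_tail_cong_prod:
  assumes r: "r > 0"
  shows "fps_X ^ Suc n dvd (\<Prod>k=1..n. 1 + (fps_X ^ r) ^ k) * (1 + 2 * theta_tail r)
           - (\<Prod>k=1..n. 1 - (fps_X ^ r) ^ k)"
proof -
  let ?q = "fps_X ^ r :: int fps"
  let ?B = "\<Prod>k=1..n. 1 + ?q ^ k" and ?C = "\<Prod>k=1..n. 1 - ?q ^ k"
  let ?S = "\<Sum>s=1..n. (-1) ^ s * ?q ^ s\<^sup>2"
  let ?R = "\<Sum>s=1..n. (-1) ^ s * ?q ^ (s * Suc n) * (\<Prod>k=1..<s. 1 + ?q ^ k) * (\<Prod>k=Suc s..n. 1 - ?q ^ k)"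
  have "fps_X ^ Suc n dvd ?R"
  proof (rule dvd_sum)
    fix s assume "s \<in> {1..n}"
    then have "Suc n \<le> r * (s * Suc n)" using r by (cases r; cases s) auto
    then have "fps_X ^ Suc n dvd ?q ^ (s * Suc n)"
      by (simp only: power_mult[symmetric] le_imp_power_dvd)
    then show "fps_X ^ Suc n dvd (-1) ^ s * ?q ^ (s * Suc n) * (\<Prod>k=1..<s. 1 + ?q ^ k) * (\<Prod>k=Suc s..n. 1 - ?q ^ k)"
      by (intro dvd_mult2 dvd_mult)
  qed
  moreover have "?B * (1 + 2 * theta_tail r) - ?C = 2 * ?B * (theta_tail r - ?S) + 2 * ?R"
    using shanks_squares[where q = ?q and n = n] by (simp add: algebra_simps del: power_Suc)
  ultimately show ?thesis
    using theta_tail_cong_sum[OF r, of n] by (simp del: power_Suc)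
qed

section \<open>Generating function of overpartitions into odd parts\<close>

definition weight_gf :: "part list set \<Rightarrow> int fps" where
  "weight_gf X = Abs_fps (\<lambda>n. int (card {x \<in> X. weight x = n}))"

definition odd_overpartitions :: "part list set" where
  "odd_overpartitions = {xs. overpartition xs \<and> odd_parts xs}"

text \<open>The bound \<open>2 * m\<close> admits exactly the \<open>m\<close> odd sizes
  \<open>2 * i + 1\<close> with \<open>i < m\<close>.\<close>

definition odd_overpartitions_below :: "nat \<Rightarrow> part list set" where
  "odd_overpartitions_below m = {xs \<in> odd_overpartitions. \<forall>p\<in>set xs. fst p < 2 * m}"

lemma finite_weight_fibre:
  assumes "X \<subseteq> odd_overpartitions"
  shows "finite {x \<in> X. weight x = n}"
  by (rule finite_subset[OF _ finite_overpartitions_le[of n]])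
    (use assms in \<open>auto simp: odd_overpartitions_def\<close>)

lemma weight_gf_Un:
  assumes "X \<subseteq> odd_overpartitions" "Y \<subseteq> odd_overpartitions" "X \<inter> Y = {}"
  shows "weight_gf (X \<union> Y) = weight_gf X + weight_gf Y"
proof (rule fps_ext)
  fix n
  have "{x \<in> X \<union> Y. weight x = n} = {x \<in> X. weight x = n} \<union> {x \<in> Y. weight x = n}" by auto
  then show "weight_gf (X \<union> Y) $ n = (weight_gf X + weight_gf Y) $ n"
    using assms by (simp add: weight_gf_def card_Un_disjoint finite_weight_fibre disjoint_iff)
qed

lemma weight_gf_Cons: "weight_gf ((#) p ` X) = fps_X ^ fst p * weight_gf X"
proof (rule fps_ext)
  fix n
  show "weight_gf ((#) p ` X) $ n = (fps_X ^ fst p * weight_gf X) $ n"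
  proof (cases "n < fst p")
    case True
    then have "{x \<in> (#) p ` X. weight x = n} = {}" by (auto simp: weight_def)
    then have "card {x \<in> (#) p ` X. weight x = n} = 0" by (simp only: card.empty)
    then show ?thesis using True by (simp add: weight_gf_def fps_X_power_mult_nth)
  next
    case False
    then have "{x \<in> (#) p ` X. weight x = n} = (#) p ` {x \<in> X. weight x = n - fst p}"
      by (auto simp: weight_def)
    then show ?thesis
      using False by (simp add: weight_gf_def fps_X_power_mult_nth card_image)
  qed
qed

text \<open>The head is a first occurrence, so its overline is free; later parts of the same size
  must be plain.\<close>

lemma overpartition_Cons:
  "overpartition (p # xs) \<longleftrightarrow> overpartition xs \<and> fst p > 0 \<and>
    (\<forall>q\<in>set xs. fst q \<le> fst p \<and> (snd q \<longrightarrow> fst q \<noteq> fst p))"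
proof -
  have *: "(\<forall>i<length (p # xs). snd ((p # xs) ! i) \<longrightarrow> (\<forall>j<i. fst ((p # xs) ! j) \<noteq> fst ((p # xs) ! i)))
    \<longleftrightarrow> (\<forall>i<length xs. snd (xs ! i) \<longrightarrow> (\<forall>j<i. fst (xs ! j) \<noteq> fst (xs ! i))) \<and>
      (\<forall>q\<in>set xs. snd q \<longrightarrow> fst q \<noteq> fst p)"
    by (auto simp: All_less_Suc2 all_set_conv_all_nth)
  show ?thesis unfolding overpartition_def * by auto
qed

text \<open>Let \<open>D\<close> hold the lists without an overlined part of the new largest size
  \<open>k = 2 * m + 1\<close>. Stripping a plain \<open>k\<close> gives
  \<open>D = F m + q^k D\<close> for the series, stripping an overlined one gives
  \<open>F (Suc m) = D + q^k D\<close>; then \<open>D\<close> is eliminated.\<close>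

lemma weight_gf_odd_overpartitions_below_Suc:
  "weight_gf (odd_overpartitions_below (Suc m)) * (1 - fps_X ^ (2 * m + 1)) =
    weight_gf (odd_overpartitions_below m) * (1 + fps_X ^ (2 * m + 1))"
proof -
  let ?k = "2 * m + 1"
  define F where "F = odd_overpartitions_below"
  define D where "D = {xs \<in> F (Suc m). (?k, True) \<notin> set xs}"
  have Cons_iff: "(j, b) # xs \<in> F (Suc m) \<longleftrightarrow>
      xs \<in> F (Suc m) \<and> odd j \<and> j \<le> ?k \<and> (\<forall>q\<in>set xs. fst q \<le> j \<and> (snd q \<longrightarrow> fst q \<noteq> j))" for j b xs
    by (auto simp: F_def odd_overpartitions_below_def odd_overpartitions_def overpartition_Cons odd_parts_def
        odd_pos)
  have odd_fst: "odd (fst q)" if "xs \<in> F j" "q \<in> set xs" for xs q j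
    using that by (simp add: F_def odd_overpartitions_below_def odd_overpartitions_def odd_parts_def)
  have below_k: "fst q \<le> ?k" if "xs \<in> F (Suc m)" "q \<in> set xs" for xs q
  proof -
    have "fst q < 2 * Suc m" using that unfolding F_def odd_overpartitions_below_def by blast
    then show ?thesis by simp
  qed
  have less_iff: "fst q < 2 * m \<longleftrightarrow> fst q \<noteq> ?k" if "xs \<in> F (Suc m)" "q \<in> set xs" for xs q
    using below_k[OF that] odd_fst[OF that] by presburger
  have Cons_k: "(?k, b) # xs \<in> F (Suc m) \<longleftrightarrow> xs \<in> D" for b xs
    unfolding Cons_iff D_def using below_k[of xs] by force
  have "xs \<in> F m \<longleftrightarrow> xs \<in> F (Suc m) \<and> (\<forall>q\<in>set xs. fst q < 2 * m)" for xs
    by (auto simp: F_def odd_overpartitions_below_def)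
  then have F_m: "xs \<in> F m \<longleftrightarrow> xs \<in> F (Suc m) \<and> (\<forall>q\<in>set xs. fst q \<noteq> ?k)" for xs
    using less_iff by blast
  \<comment> \<open>Parts are non-increasing, so if size \<open>2 * m + 1\<close> occurs at all, it
    occurs at the head.\<close>
  have head_k: "\<exists>b ys. xs = (?k, b) # ys" if "xs \<in> F (Suc m)" "xs \<notin> F m" for xs
  proof (cases xs)
    case Nil
    then show ?thesis using that by (simp add: F_m)
  next
    case (Cons p ys)
    obtain j b where p: "p = (j, b)" by (cases p)
    have xs: "(j, b) # ys \<in> F (Suc m)" using that(1) Cons p by simp
    have "j = ?k"
    proof (rule ccontr)
      assume "j \<noteq> ?k"
      then have "j < ?k" using below_k[OF xs] by force
      then have "fst q \<noteq> ?k" if "q \<in> set xs" for q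
        using that xs Cons_iff[of j b ys] unfolding Cons p by auto
      then show False using that F_m by blast
    qed
    then show ?thesis using Cons p by auto
  qed
  have D_eq: "D = F m \<union> (#) (?k, False) ` D"
  proof (intro equalityI subsetI)
    fix xs assume "xs \<in> D"
    then show "xs \<in> F m \<union> (#) (?k, False) ` D"
      using head_k[of xs] Cons_k by (fastforce simp: D_def)
  next
    fix xs assume "xs \<in> F m \<union> (#) (?k, False) ` D"
    then show "xs \<in> D"
      using Cons_k by (auto simp: D_def F_m)
  qed
  have F_eq: "F (Suc m) = D \<union> (#) (?k, True) ` D"
  proof (intro equalityI subsetI)
    fix xs assume xs: "xs \<in> F (Suc m)"
    show "xs \<in> D \<union> (#) (?k, True) ` D"
    proof (cases "xs \<in> D")
      case False
      then obtain b ys where ys: "xs = (?k, b) # ys" using head_k[of xs] xs D_eq by blast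
      then have "ys \<in> D" using Cons_k xs by simp
      then show ?thesis using ys D_eq by (cases b) auto
    qed simp
  next
    fix xs assume "xs \<in> D \<union> (#) (?k, True) ` D"
    then show "xs \<in> F (Suc m)" using Cons_k by (auto simp: D_def)
  qed
  have sub: "F j \<subseteq> odd_overpartitions" for j by (auto simp: F_def odd_overpartitions_below_def)
  have sub': "(#) (?k, b) ` D \<subseteq> odd_overpartitions" for b
    using Cons_k sub[of "Suc m"] by blast
  have "D \<subseteq> F (Suc m)" by (auto simp: D_def)
  with sub have D_sub: "D \<subseteq> odd_overpartitions" by blast
  have disj: "F m \<inter> (#) (?k, False) ` D = {}" "D \<inter> (#) (?k, True) ` D = {}"
    by (auto simp: F_m D_def)
  have "weight_gf D = weight_gf (F m) + fps_X ^ ?k * weight_gf D"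
    using weight_gf_Un[OF sub sub' disj(1), folded D_eq] by (simp only: weight_gf_Cons fst_conv)
  moreover have "weight_gf (F (Suc m)) = weight_gf D + fps_X ^ ?k * weight_gf D"
    using weight_gf_Un[OF D_sub sub' disj(2), folded F_eq] by (simp only: weight_gf_Cons fst_conv)
  ultimately have "weight_gf (F m) = weight_gf D * (1 - fps_X ^ ?k)"
    and "weight_gf (F (Suc m)) = weight_gf D * (1 + fps_X ^ ?k)"
    by (simp_all only: algebra_simps) (simp_all add: algebra_simps)
  then show ?thesis by (simp only: F_def mult_ac)
qed

lemma weight_gf_odd_overpartitions_below:
  "weight_gf (odd_overpartitions_below m) * (\<Prod>i<m. 1 - fps_X ^ (2 * i + 1)) =
    (\<Prod>i<m. 1 + fps_X ^ (2 * i + 1))"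
proof (induction m)
  case 0
  have "xs \<in> odd_overpartitions_below 0 \<longleftrightarrow> xs = []" for xs
    by (cases xs)
      (auto simp: odd_overpartitions_below_def odd_overpartitions_def overpartition_def odd_parts_def)
  then have "odd_overpartitions_below 0 = {[]}" by blast
  have "weight_gf (odd_overpartitions_below 0) = 1"
  proof (intro fps_ext)
    fix n
    have "{x \<in> {[] :: part list}. weight x = n} = (if n = 0 then {[]} else {})"
      by (auto simp: weight_def)
    then show "weight_gf (odd_overpartitions_below 0) $ n = 1 $ n"
      using \<open>odd_overpartitions_below 0 = {[]}\<close> by (simp add: weight_gf_def)
  qed
  then show ?case by simp
next
  case (Suc m)
  let ?F = "\<lambda>m. weight_gf (odd_overpartitions_below m)" and ?x = "fps_X ^ (2 * m + 1) :: int fps"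
  let ?A = "\<Prod>i<m. 1 - fps_X ^ (2 * i + 1) :: int fps"
  have "?F (Suc m) * (?A * (1 - ?x)) = (?F (Suc m) * (1 - ?x)) * ?A" by (simp only: mult_ac)
  also have "\<dots> = (?F m * ?A) * (1 + ?x)"
    unfolding weight_gf_odd_overpartitions_below_Suc by (simp only: mult_ac)
  finally show ?case by (simp only: Suc.IH prod.lessThan_Suc)
qed

text \<open>A list of weight below \<open>2 * m\<close> has only parts below
  \<open>2 * m\<close>.\<close>

lemma weight_gf_below_cong:
  "fps_X ^ (2 * m) dvd weight_gf odd_overpartitions - weight_gf (odd_overpartitions_below m)"
proof -
  have "{x \<in> odd_overpartitions. weight x = k} = {x \<in> odd_overpartitions_below m. weight x = k}"
    if k: "k < 2 * m" for k
  proof -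
    have "fst p \<le> weight xs" if "p \<in> set xs" for p xs
      using that member_le_sum_list[of "fst p" "map fst xs"] by (auto simp: weight_def)
    then show ?thesis using k by (fastforce simp: odd_overpartitions_below_def)
  qed
  then show ?thesis by (simp add: fps_X_power_dvd_iff weight_gf_def)
qed

lemma OPT_eq_nth: "int (OPT n) = (weight_gf odd_overpartitions ^ 3) $ n"
proof -
  let ?S = "\<lambda>k. {x \<in> odd_overpartitions. weight x = k}"
  let ?G = "weight_gf odd_overpartitions"
  have fin: "finite (?S k)" for k by (rule finite_weight_fibre) simp
  have "odd_overpartition_triples n =
      (\<Union>i\<in>{0..n}. \<Union>j\<in>{0..n - i}. ?S i \<times> ?S j \<times> ?S (n - i - j))"
    by (auto simp: odd_overpartition_triples_def odd_overpartitions_def)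
  then have "OPT n = card (\<Union>i\<in>{0..n}. \<Union>j\<in>{0..n - i}. ?S i \<times> ?S j \<times> ?S (n - i - j))"
    by (simp add: OPT_def)
  also have "\<dots> = (\<Sum>i=0..n. card (\<Union>j\<in>{0..n - i}. ?S i \<times> ?S j \<times> ?S (n - i - j)))"
    by (rule card_UN_disjoint) (use fin in auto)
  also have "\<dots> = (\<Sum>i=0..n. \<Sum>j=0..n - i. card (?S i \<times> ?S j \<times> ?S (n - i - j)))"
    by (intro sum.cong refl card_UN_disjoint) (use fin in auto)
  finally have "int (OPT n) = (?G * (?G * ?G)) $ n"
    by (simp add: fps_mult_nth weight_gf_def card_cartesian_product sum_distrib_left)
  then show ?thesis by (simp add: power3_eq_cube mult.assoc)
qed

section \<open>The generating function as a quotient of theta series\<close>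

text \<open>Cancelling the odd factors of Gauss's products for \<open>\<phi>(-q)\<close> and \<open>\<phi>(-q\<^sup>2)\<close> shows
  that the generating function is \<open>\<phi>(-q\<^sup>2) / \<phi>(-q)\<close>.\<close>

lemma weight_gf_mult_theta:
  "weight_gf odd_overpartitions * (1 + 2 * theta_tail 1) = 1 + 2 * theta_tail 2"
proof -
  let ?G = "weight_gf odd_overpartitions" and ?t = "1 + 2 * theta_tail 1" and ?u = "1 + 2 * theta_tail 2"
  have "fps_X ^ m dvd ?G * ?t - ?u" for m
  proof -
    define Om Op Em Ep :: "int fps" where
      "Om = (\<Prod>i<m. 1 - fps_X ^ (2 * i + 1))" and "Op = (\<Prod>i<m. 1 + fps_X ^ (2 * i + 1))" and
      "Em = (\<Prod>k=1..m. 1 - (fps_X ^ 2) ^ k)" and "Ep = (\<Prod>k=1..m. 1 + (fps_X ^ 2) ^ k)"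
    \<comment> \<open>Separating odd from even indices makes the product for
      \<open>\<phi>(-q)\<close> of length \<open>2 * m\<close> share its even factors with the one
      for \<open>\<phi>(-q\<^sup>2)\<close> of length \<open>m\<close>.\<close>
    have split: "(\<Prod>k=1..2 * m. f k) = (\<Prod>i<m. f (2 * i + 1)) * (\<Prod>k=1..m. f (2 * k))"
      for f :: "nat \<Rightarrow> int fps"
      by (induction m) (simp_all add: mult_ac)
    define H where "H = weight_gf (odd_overpartitions_below m)"
    have H: "H * Om = Op"
      unfolding H_def Om_def Op_def by (rule weight_gf_odd_overpartitions_below)
    have GH: "fps_X ^ m dvd ?G - H"
      using weight_gf_below_cong[of m] unfolding H_def
      by (rule dvd_trans[rotated]) (simp add: le_imp_power_dvd)
    have t: "fps_X ^ m dvd Op * Ep * ?t - Om * Em"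
    proof -
      have "fps_X ^ Suc (2 * m) dvd Op * Ep * ?t - Om * Em"
        using theta_tail_cong_prod[OF zero_less_one, of "2 * m"]
        by (simp only: power_one_right split Op_def Ep_def Om_def Em_def power_mult)
      then show ?thesis by (rule dvd_trans[rotated]) (rule le_imp_power_dvd, simp)
    qed
    have u: "fps_X ^ m dvd Ep * ?u - Em"
      using theta_tail_cong_prod[of 2 m]
      by (simp add: Ep_def Em_def) (metis dvd_mult_right)
    \<comment> \<open>A combination of the congruences \<open>GH\<close>, \<open>t\<close> and
      \<open>u\<close>; the last summand is zero by \<open>H\<close>. The multiplier has constant
      term 1 and can be cancelled.\<close>
    have "(?G * ?t - ?u) * (Ep * Om * Op) = (?G - H) * (?t * Ep * Om * Op)
        + (H * Om) * (Op * Ep * ?t - Om * Em) - (Ep * ?u - Em) * (Om * Op)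
        + (H * Om - Op) * (Om * Em)"
      by (simp add: algebra_simps)
    then have "fps_X ^ m dvd (?G * ?t - ?u) * (Ep * Om * Op)"
      using GH t u by (simp add: H)
    moreover have "(Ep * Om * Op) $ 0 = 1"
    proof -
      have *: "prod f A $ 0 = 1" if "\<And>x. x \<in> A \<Longrightarrow> f x $ 0 = 1" for f :: "nat \<Rightarrow> int fps" and A
        using that by (induction A rule: infinite_finite_induct) auto
      have "Ep $ 0 = 1" "Om $ 0 = 1" "Op $ 0 = 1"
        unfolding Ep_def Om_def Op_def by (rule *; auto simp flip: power_mult)+
      then show ?thesis by simp
    qed
    ultimately show ?thesis by (rule fps_X_power_dvd_cancel)
  qed
  then have "(?G * ?t - ?u) $ k = 0" for k
    using fps_X_power_dvd_iff[of "Suc k" "?G * ?t - ?u"] by blast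
  then have "?G * ?t - ?u = 0" by (intro fps_ext) simp
  then show ?thesis by simp
qed

section \<open>Squares of series modulo 2\<close>

text \<open>Swapping \<open>i\<close> and \<open>n - i\<close> pairs off all terms but the middle
  one, and an integer square is congruent to its root modulo 2.\<close>

lemma fps_square_nth_cong_2:
  fixes f :: "int fps"
  shows "2 dvd (f\<^sup>2) $ n - (if even n then f $ (n div 2) else 0)"
proof -
  let ?g = "\<lambda>i. f $ i * f $ (n - i)"
  let ?L = "{i. 2 * i < n}" and ?M = "{i. 2 * i = n}" and ?U = "{i. i \<le> n \<and> 2 * i > n}"
  have fin: "finite ?L" "finite ?M" "finite ?U"
    by (rule finite_subset[of _ "{..n}"]; auto)+
  have "{0..n} = ?L \<union> ?M \<union> ?U" by auto
  then have "(f\<^sup>2) $ n = sum ?g (?L \<union> ?M \<union> ?U)"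
    by (simp add: power2_eq_square fps_mult_nth)
  also have "\<dots> = sum ?g ?L + sum ?g ?M + sum ?g ?U"
    using fin by (subst sum.union_disjoint; (subst sum.union_disjoint)?; auto)
  also have "sum ?g ?U = sum ?g ?L"
    by (rule sum.reindex_bij_witness[of _ "\<lambda>i. n - i" "\<lambda>i. n - i"]) auto
  also have "sum ?g ?M = (if even n then (f $ (n div 2))\<^sup>2 else 0)"
  proof (cases "even n")
    case True
    then have "?M = {n div 2}" "n - n div 2 = n div 2" by auto
    then show ?thesis using True by (simp add: power2_eq_square)
  next
    case False
    then have "?M = {}" by auto
    then show ?thesis using False by simp
  qed
  finally show ?thesis by simp
qed

lemma theta_tail_square_cong_2:
  "\<exists>L. (theta_tail r)\<^sup>2 = theta_tail (2 * r) + 2 * L"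
proof -
  let ?D = "(theta_tail r)\<^sup>2 - theta_tail (2 * r)"
  have "2 dvd ?D $ n" for n
  proof -
    have "(if even n then theta_tail r $ (n div 2) else 0) = theta_tail (2 * r) $ n"
    proof (cases "even n")
      case True
      then obtain j where "n = 2 * j" by blast
      then show ?thesis by (simp add: theta_tail_def mult.assoc)
    next
      case False
      then have "theta_tail (2 * r) $ n = 0" by (intro theta_tail_nth_eq_0) auto
      then show ?thesis using False by simp
    qed
    with fps_square_nth_cong_2[of "theta_tail r" n] show ?thesis by simp
  qed
  then have "?D = 2 * Abs_fps (\<lambda>n. ?D $ n div 2)"
    by (intro fps_ext) (simp add: fps_numeral_fps_const)
  then have "(theta_tail r)\<^sup>2 = theta_tail (2 * r) + 2 * Abs_fps (\<lambda>n. ?D $ n div 2)"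
    by (metis add.commute diff_add_cancel)
  then show ?thesis by blast
qed

section \<open>Numbers not represented by two binary quadratic forms\<close>

text \<open>For \<open>a = 0\<close> the right side is 3 modulo 4, impossible for two squares.
  Otherwise \<open>u = (x + y) / 2\<close> and \<open>v = (x - y) / 2\<close> represent half the
  number.\<close>

lemma square_plus_square_neq:
  fixes x y :: int
  shows "x\<^sup>2 + y\<^sup>2 \<noteq> 2 ^ a * (8 * m + 7)"
proof (induction a arbitrary: x y)
  case 0
  have "(x\<^sup>2 + y\<^sup>2) mod 4 \<noteq> 3" for x y :: int
  proof -
    have sq: "z\<^sup>2 mod 4 \<in> {0, 1}" for z :: int
    proof -
      have "z mod 4 = 0 \<or> z mod 4 = 1 \<or> z mod 4 = 2 \<or> z mod 4 = 3" by presburger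
      then have "(z mod 4)\<^sup>2 mod 4 \<in> {0, 1}" by auto
      then show ?thesis by (simp add: power_mod)
    qed
    have "(x\<^sup>2 + y\<^sup>2) mod 4 = (x\<^sup>2 mod 4 + y\<^sup>2 mod 4) mod 4" by (simp add: mod_simps)
    then show ?thesis using sq[of x] sq[of y] by auto
  qed
  moreover have "(8 * m + 7) mod 4 = 3" by presburger
  ultimately show ?case by (metis mult_1 power_0)
next
  case (Suc a)
  show ?case
  proof
    assume eq: "x\<^sup>2 + y\<^sup>2 = 2 ^ Suc a * (8 * m + 7)"
    then have "even (x\<^sup>2 + y\<^sup>2)" by simp
    then have "even (x + y)" "even (x - y)" by auto
    then obtain u v where "x + y = 2 * u" "x - y = 2 * v" by (metis dvdE)
    then have xy: "x = u + v" "y = u - v" by auto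
    have "2 * (u\<^sup>2 + v\<^sup>2) = 2 * (2 ^ a * (8 * m + 7))"
      using eq unfolding xy by (simp add: power2_eq_square algebra_simps)
    then show False using Suc.IH[of u v] by (metis mult_cancel_left zero_neq_numeral)
  qed
qed

text \<open>For \<open>a = 0\<close> squares modulo 8 are 0, 1 or 4, which excludes 7. Otherwise
  \<open>x = 2 * u\<close>, and halving gives the same form with the roles swapped, at
  \<open>y\<close> and \<open>u\<close>.\<close>

lemma square_plus_double_square_neq:
  fixes x y :: int
  shows "x\<^sup>2 + 2 * y\<^sup>2 \<noteq> 2 ^ a * (8 * m + 7)"
proof (induction a arbitrary: x y)
  case 0
  have "(x\<^sup>2 + 2 * y\<^sup>2) mod 8 \<noteq> 7"
  proof -
    have sq: "z\<^sup>2 mod 8 \<in> {0, 1, 4}" for z :: int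
    proof -
      have "z mod 8 = 0 \<or> z mod 8 = 1 \<or> z mod 8 = 2 \<or> z mod 8 = 3 \<or>
          z mod 8 = 4 \<or> z mod 8 = 5 \<or> z mod 8 = 6 \<or> z mod 8 = 7" by presburger
      then have "(z mod 8)\<^sup>2 mod 8 \<in> {0, 1, 4}" by auto
      then show ?thesis by (simp add: power_mod)
    qed
    have "(x\<^sup>2 + 2 * y\<^sup>2) mod 8 = (x\<^sup>2 mod 8 + 2 * (y\<^sup>2 mod 8)) mod 8"
      by (metis mod_add_left_eq mod_add_right_eq mod_mult_right_eq)
    then show ?thesis using sq[of x] sq[of y] by auto
  qed
  moreover have "(8 * m + 7) mod 8 = 7" by presburger
  ultimately show ?case by (metis mult_1 power_0)
next
  case (Suc a)
  show ?case
  proof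
    assume eq: "x\<^sup>2 + 2 * y\<^sup>2 = 2 ^ Suc a * (8 * m + 7)"
    then have "x\<^sup>2 = 2 * (2 ^ a * (8 * m + 7) - y\<^sup>2)" by simp
    then have "even (x\<^sup>2)" by simp
    then obtain u where "x = 2 * u" by (auto elim!: evenE)
    then have "2 * (y\<^sup>2 + 2 * u\<^sup>2) = 2 * (2 ^ a * (8 * m + 7))"
      using eq by (simp add: power2_eq_square algebra_simps)
    then show False using Suc.IH[of y u] by (metis mult_cancel_left zero_neq_numeral)
  qed
qed

lemma theta_tail_mult_nth_eq_0:
  assumes "\<And>x y. r * x\<^sup>2 + s * y\<^sup>2 \<noteq> n"
  shows "(theta_tail r * theta_tail s) $ n = 0"
  unfolding fps_mult_nth
proof (rule sum.neutral, rule ballI)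
  fix i assume i: "i \<in> {0..n}"
  show "theta_tail r $ i * theta_tail s $ (n - i) = 0"
  proof (rule ccontr)
    assume "\<not> ?thesis"
    then obtain x y where "i = r * x\<^sup>2" "n - i = s * y\<^sup>2"
      using theta_tail_nth_eq_0 by (metis mult_eq_0_iff)
    then show False using i assms[of x y] by auto
  qed
qed

section \<open>Reduction modulo 16\<close>

text \<open>Modulo 16 we have \<open>(1 + 2 A)\<^sup>8 = 1\<close>, so \<open>G (1 + 2 A) = 1 + 2 B\<close> gives
  \<open>G\<^sup>3 = (1 + 2 B)\<^sup>3 (1 + 2 A)\<^sup>5\<close>.\<close>

lemma cube_mod_16:
  fixes G A B C L :: "'a::comm_ring_1"
  assumes G: "G * (1 + 2 * A) = 1 + 2 * B" and B: "B\<^sup>2 = C + 2 * L"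
  shows "\<exists>K. G ^ 3 = 1 + 10 * A + 6 * B + 40 * A\<^sup>2 + 60 * (A * B) + 12 * B\<^sup>2
           + 8 * (A * C) + 8 * (B * C) + 16 * K"
proof -
  define t where "t = 1 + 2 * A"
  define M where "M = (A + A\<^sup>2) + 2 * (A + A\<^sup>2)\<^sup>2"
  \<comment> \<open>Each squaring gains a factor 2: \<open>1 + 4 x\<close>, then
    \<open>1 + 8 x\<close>, then \<open>1 + 16 x\<close>.\<close>
  have t2: "t\<^sup>2 = 1 + 4 * (A + A\<^sup>2)" by (simp add: t_def power2_eq_square algebra_simps)
  have t4: "t ^ 4 = 1 + 8 * M"
  proof -
    have "t ^ 4 = (t\<^sup>2)\<^sup>2" by (simp flip: power_mult)
    also have "\<dots> = 1 + 8 * M" unfolding t2 M_def by (simp add: power2_eq_square algebra_simps)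
    finally show ?thesis .
  qed
  have t8: "t ^ 8 = 1 + 16 * (M + 4 * M\<^sup>2)"
  proof -
    have "t ^ 8 = (t ^ 4)\<^sup>2" by (simp flip: power_mult)
    also have "\<dots> = 1 + 16 * (M + 4 * M\<^sup>2)" unfolding t4 by (simp add: power2_eq_square algebra_simps)
    finally show ?thesis .
  qed
  have t5: "t ^ 5 = 1 + 10 * A + 40 * A\<^sup>2 + 80 * A ^ 3 + 80 * A ^ 4 + 32 * A ^ 5"
    by (simp add: t_def eval_nat_numeral algebra_simps)
  have b3: "(1 + 2 * B) ^ 3 = 1 + 6 * B + 12 * B\<^sup>2 + 8 * B ^ 3"
    by (simp add: eval_nat_numeral algebra_simps)
  define U where "U = 5 * A ^ 3 + 5 * A ^ 4 + 2 * A ^ 5"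
  have t5': "t ^ 5 = 1 + 10 * A + 40 * A\<^sup>2 + 16 * U"
    unfolding t5 U_def by (simp add: algebra_simps)
  have "G ^ 3 * t ^ 8 = (G * t) ^ 3 * t ^ 5"
    by (simp add: power_mult_distrib mult.assoc flip: power_add)
  also have "\<dots> = (1 + 6 * B + 12 * B\<^sup>2 + 8 * B ^ 3) * (1 + 10 * A + 40 * A\<^sup>2 + 16 * U)"
    using G by (simp only: t_def[symmetric] t5' b3)
  finally have "G ^ 3 = (1 + 6 * B + 12 * B\<^sup>2 + 8 * B ^ 3) * (1 + 10 * A + 40 * A\<^sup>2 + 16 * U)
      - 16 * (G ^ 3 * (M + 4 * M\<^sup>2))"
    unfolding t8 by (simp add: algebra_simps)
  also have "\<dots> = (1 + 6 * B + 12 * B\<^sup>2 + 8 * B * B\<^sup>2) * (1 + 10 * A + 40 * A\<^sup>2)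
      + 16 * (U * (1 + 6 * B + 12 * B\<^sup>2 + 8 * B ^ 3) - G ^ 3 * (M + 4 * M\<^sup>2))"
    by (simp add: power3_eq_cube power2_eq_square algebra_simps)
  \<comment> \<open>The mixed term has \<open>120 = 8 + 16 * 7\<close>; the other coefficients moved
    out are 240, 480, 80 and 320, all divisible by 16.\<close>
  also have "(1 + 6 * B + 12 * B\<^sup>2 + 8 * B * B\<^sup>2) * (1 + 10 * A + 40 * A\<^sup>2) =
      1 + 10 * A + 6 * B + 40 * A\<^sup>2 + 60 * (A * B) + 12 * B\<^sup>2 + 8 * (A * B\<^sup>2) + 8 * (B * B\<^sup>2)
      + 16 * (15 * A\<^sup>2 * B + 7 * A * B\<^sup>2 + 30 * A\<^sup>2 * B\<^sup>2 + 5 * A * B * B\<^sup>2 + 20 * A\<^sup>2 * B * B\<^sup>2)"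
    by (simp add: power2_eq_square algebra_simps)
  \<comment> \<open>Under the factor 8 only \<open>B\<^sup>2\<close> modulo 2 matters, so cubic
    terms become products of two theta tails.\<close>
  also have "8 * (A * B\<^sup>2) = 8 * (A * C) + 16 * (A * L)" unfolding B by (simp add: algebra_simps)
  also have "8 * (B * B\<^sup>2) = 8 * (B * C) + 16 * (B * L)" unfolding B by (simp add: algebra_simps)
  finally have "G ^ 3 = 1 + 10 * A + 6 * B + 40 * A\<^sup>2 + 60 * (A * B) + 12 * B\<^sup>2
      + 8 * (A * C) + 8 * (B * C)
      + 16 * (A * L + B * L
        + (15 * A\<^sup>2 * B + 7 * A * B\<^sup>2 + 30 * A\<^sup>2 * B\<^sup>2 + 5 * A * B * B\<^sup>2 + 20 * A\<^sup>2 * B * B\<^sup>2)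
        + (U * (1 + 6 * B + 12 * B\<^sup>2 + 8 * B ^ 3) - G ^ 3 * (M + 4 * M\<^sup>2)))"
    by (simp only: distrib_left add_ac)
  then show ?thesis by blast
qed

theorem theorem2p3:
  fixes n \<alpha> :: nat
  shows "[OPT (2 ^ \<alpha> * (8 * n + 7)) = 0] (mod 16)"
proof -
  define N where "N = 2 ^ \<alpha> * (8 * n + 7)"
  have N: "int N = 2 ^ \<alpha> * (8 * int n + 7)" by (simp add: N_def)
  let ?A = "theta_tail 1" and ?B = "theta_tail 2" and ?C = "theta_tail 4"
  let ?G = "weight_gf odd_overpartitions"
  have f1: "x\<^sup>2 + y\<^sup>2 \<noteq> N" for x y
    using square_plus_square_neq[of "int x" "int y" \<alpha> "int n"] unfolding N[symmetric]
    by (metis of_nat_add of_nat_power)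
  have f2: "x\<^sup>2 + 2 * y\<^sup>2 \<noteq> N" for x y
    using square_plus_double_square_neq[of "int x" "int y" \<alpha> "int n"] unfolding N[symmetric]
    by (metis of_nat_add of_nat_power of_nat_mult of_nat_numeral)
  have f3: "2 * x\<^sup>2 + 2 * y\<^sup>2 \<noteq> N" for x y
  proof
    assume "2 * x\<^sup>2 + 2 * y\<^sup>2 = N"
    then have "2 * (int x)\<^sup>2 + 2 * (int y)\<^sup>2 = int N" by auto
    \<comment> \<open>The doubled form is again a sum of two squares; integers allow
      \<open>x < y\<close>.\<close>
    then have "(int x + int y)\<^sup>2 + (int x - int y)\<^sup>2 = int N"
      by (simp add: power2_eq_square algebra_simps)
    then show False using square_plus_square_neq N by metis
  qed
  \<comment> \<open>The forms belonging to \<open>?C\<close> reduce to the earlier ones through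
    \<open>4 * y\<^sup>2 = (2 * y)\<^sup>2\<close>.\<close>
  have "x\<^sup>2 + 4 * y\<^sup>2 \<noteq> N" for x y using f1[of x "2 * y"] by (simp add: power_mult_distrib)
  moreover have "2 * x\<^sup>2 + 4 * y\<^sup>2 \<noteq> N" for x y
    using f2[of "2 * y" x] by (simp add: power_mult_distrib add.commute)
  ultimately have binary: "(?A * ?A) $ N = 0" "(?A * ?B) $ N = 0" "(?B * ?B) $ N = 0"
      "(?A * ?C) $ N = 0" "(?B * ?C) $ N = 0"
    using f1 f2 f3 by (simp_all add: theta_tail_mult_nth_eq_0)
  have "N \<noteq> k\<^sup>2" "N \<noteq> 2 * k\<^sup>2" for k
    using f1[of k 0] f2[of 0 k] by auto
  then have unary: "?A $ N = 0" "?B $ N = 0"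
    by (simp_all add: theta_tail_nth_eq_0)
  have "N > 0" by (simp add: N_def)
  obtain L where "?B\<^sup>2 = ?C + 2 * L"
    using theta_tail_square_cong_2[of 2] by auto
  from cube_mod_16[OF weight_gf_mult_theta this] obtain K where
    "?G ^ 3 = 1 + 10 * ?A + 6 * ?B + 40 * ?A\<^sup>2 + 60 * (?A * ?B) + 12 * ?B\<^sup>2
       + 8 * (?A * ?C) + 8 * (?B * ?C) + 16 * K" by blast
  \<comment> \<open>\<open>N > 0\<close> removes the constant 1, and every other term outside
    \<open>16 * K\<close> vanishes at \<open>N\<close>.\<close>
  then have "(?G ^ 3) $ N = 16 * K $ N"
    using unary binary \<open>N > 0\<close>
    by (simp add: power2_eq_square numeral_fps_const)
  then have "16 dvd int (OPT N)" by (simp add: OPT_eq_nth)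
  then have "16 dvd OPT N" by presburger
  then show ?thesis by (simp add: N_def cong_0_iff)
qed

end
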